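(* Let $E$ be an exact Courant algebroid over a smooth manifold $M$ with (semi-Riemannian) generalised metric $\mathcal G$, and let $D$ be the canonical generalised Levi-Civita connection with metric divergence. Then we have the following connection coefficients for any sections $u,v,w$ (respectively $u,\bar v,\bar w$) of $E$ with constant (pairwise) scalar products. (1) Pure-type coefficients: for $u,v,w\in\Gamma(E_\pm)$, $$\langle D_uv,w\rangle=\left(\tfrac16(\pi^*H)\pm\Gamma\right)(u,v,w).$$ (2) Mixed-type coefficients: $$\langle D_u\bar v,\bar w\rangle=\left(\tfrac12(\pi^*H)-\Gamma\right)(u,\bar v,\bar w),\quad u\in\Gamma(E_+),\ \bar v,\bar w\in\Gamma(E_-),$$ $$\langle D_u\bar v,\bar w\rangle=\left(\tfrac12(\pi^*H)+\Gamma\right)(u,\bar v,\bar w),\quad u\in\Gamma(E_-),\ \bar v,\bar w\in\Gamma(E_+).$$ Here $(\pi^*H)(u,v,w)=H(\pi u,\pi v,\pi w)$ and $\Gamma(u,v,w)=g(\nabla_{\pi u}\pi v,\pi w)$.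
   Context: **Setting.** $(E,\pi,\langle\cdot,\cdot\rangle,[\cdot,\cdot])$ is an exact Courant algebroid over $M$: the bracket is the Dorfman bracket and $0\to T^*M\to E\xrightarrow{\pi}TM\to0$ is exact. A (semi-Riemannian) generalised metric is a nondegenerate symmetric bilinear form $\mathcal G$ on $E$ such that the endomorphism $\mathcal G^{\mathrm{End}}$ defined by $\langle\mathcal G^{\mathrm{End}}u,v\rangle=\mathcal G(u,v)$ is an involution and $\mathcal G|_{T^*M}$ is nondegenerate. $E_\pm$ are the $\pm1$-eigenbundles of $\mathcal G^{\mathrm{End}}$, so $E=E_+\oplus E_-$ orthogonally and $\mathcal G=\pm\langle\cdot,\cdot\rangle$ on $E_\pm$. The maps $\pi_\pm=\pi|_{E_\pm}:E_\pm\to TM$ are isomorphisms, and $g$ is the semi-Riemannian metric on $M$ with $(\pi_\pm)^*g=\mathcal G|_{E_\pm\times E_\pm}$. $\nabla$ is the Levi-Civita connection of $g$. The map $\phi:E\to\mathbb TM=TM\oplus T^*M$, $\phi|_{E_\pm}=(1\pm g)\circ\pi_\pm$, is an isomorphism of Courant algebroids onto $\mathbb TM$ with anchor the projection to $TM$, scalar product $\langle X+\xi,Y+\zeta\rangle=\frac12(\xi(Y)+\zeta(X))$ and bracket $[X+\xi,Y+\zeta]_H=\mathcal L_XY+\mathcal L_X\zeta-\iota_Yd\xi+H(X,Y,\cdot)$, where $H$ is a closed three-form on $M$ determined in this way. **Generalised connections.** A generalised connection is an $\mathbb R$-bilinear map $D:\Gamma(E)\times\Gamma(E)\to\Gamma(E)$,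 $(u,v)\mapsto D_uv$, $C^\infty(M)$-linear in $u$, with $D_u(fv)=(\pi(u)f)v+fD_uv$ and $\pi(u)\langle v,w\rangle=\langle D_uv,w\rangle+\langle v,D_uw\rangle$. Its torsion is $T(u,v,w)=\langle D_uv-D_vu-[u,v],w\rangle+\langle D_wu,v\rangle$. **Canonical connection with metric divergence.** Let $\widetilde D$ be the generalised connection with $\widetilde D_u=\pi_\pm^{-1}\circ\nabla_{\pi(u)}\circ\pi_\pm$ on $\Gamma(E_\pm)$ for $u\in\Gamma(E_\pm)$, and $\widetilde D_u=[u,\cdot]_\mp$ on $\Gamma(E_\mp)$ for $u\in\Gamma(E_\pm)$ (subscripts on brackets denote projection to $E_\mp$). Its torsion $\widetilde T$ is totally skew. The canonical generalised Levi-Civita connection with metric divergence is $D$ defined by $\langle D_uv,w\rangle=\langle\widetilde D_uv,w\rangle-\frac13\widetilde T(u,v,w)$. *)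

theory Defs
  imports "HOL-Analysis.Analysis" "HOL-Library.Function_Algebras"
begin

section \<open>Linear algebra on subspaces\<close>

text \<open>
  Functions into a real vector space form a real vector space pointwise.  Tangent vectors
  (derivations of the algebra of smooth functions) and sections of bundles are functions.
\<close>

instantiation "fun" :: (type, real_vector) real_vector
begin

definition scaleR_fun_def: "c *\<^sub>R f = (\<lambda>x. c *\<^sub>R f x)"

instance
  by standard (auto simp: scaleR_fun_def fun_eq_iff algebra_simps)

end

definition linear_on :: "'a::real_vector set \<Rightarrow> ('a \<Rightarrow> 'b::real_vector) \<Rightarrow> bool" where
  "linear_on V f \<longleftrightarrow>
     (\<forall>a\<in>V. \<forall>b\<in>V. f (a + b) = f a + f b) \<and> (\<forall>c. \<forall>a\<in>V. f (c *\<^sub>R a) = c *\<^sub>R f a)"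

definition nondegenerate_on :: "'a::real_vector set \<Rightarrow> ('a \<Rightarrow> 'a \<Rightarrow> real) \<Rightarrow> bool" where
  "nondegenerate_on V b \<longleftrightarrow> (\<forall>a\<in>V. (\<forall>c\<in>V. b a c = 0) \<longrightarrow> a = 0)"

definition scalar_product_on :: "'a::real_vector set \<Rightarrow> ('a \<Rightarrow> 'a \<Rightarrow> real) \<Rightarrow> bool" where
  "scalar_product_on V b \<longleftrightarrow>
     (\<forall>a\<in>V. linear_on V (b a)) \<and> (\<forall>a\<in>V. linear_on V (\<lambda>c. b c a)) \<and>
     (\<forall>a\<in>V. \<forall>c\<in>V. b a c = b c a) \<and> nondegenerate_on V b"

section \<open>Smooth manifolds\<close>

primrec C_k_on :: "nat \<Rightarrow> 'a::euclidean_space set \<Rightarrow> ('a \<Rightarrow> 'b::real_normed_vector) \<Rightarrow> bool" where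
  "C_k_on 0 S f \<longleftrightarrow> continuous_on S f"
| "C_k_on (Suc k) S f \<longleftrightarrow>
     (\<forall>x\<in>S. f differentiable (at x)) \<and>
     (\<forall>v. C_k_on k S (\<lambda>x. frechet_derivative f (at x) v))"

text \<open>Only meaningful for open \<open>S\<close>.\<close>

definition smooth_on :: "'a::euclidean_space set \<Rightarrow> ('a \<Rightarrow> 'b::real_normed_vector) \<Rightarrow> bool" where
  "smooth_on S f \<longleftrightarrow> (\<forall>k. C_k_on k S f)"

text \<open>
  The manifold is the whole type \<open>'m\<close>; its smooth structure is given by an atlas of
  charts \<open>(U, \<kappa>)\<close>.  Only the values of \<open>\<kappa>\<close> on \<open>U\<close> matter.
\<close>

type_synonym ('m, 'n) atlas = "('m set \<times> ('m \<Rightarrow> 'n)) set"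

definition smooth_manifold ::
  "('m::{t2_space,second_countable_topology}, 'n::euclidean_space) atlas \<Rightarrow> bool" where
  "smooth_manifold M \<longleftrightarrow>
     (\<Union>(U, \<kappa>)\<in>M. U) = UNIV \<and>
     (\<forall>(U, \<kappa>)\<in>M. open U \<and> open (\<kappa> ` U) \<and> homeomorphism U (\<kappa> ` U) \<kappa> (inv_into U \<kappa>)) \<and>
     (\<forall>(U, \<kappa>)\<in>M. \<forall>(V, \<kappa>')\<in>M. smooth_on (\<kappa> ` (U \<inter> V)) (\<kappa>' \<circ> inv_into U \<kappa>))"

definition smooth_fun_on ::
  "('m, 'n::euclidean_space) atlas \<Rightarrow> 'm set \<Rightarrow> ('m \<Rightarrow> real) \<Rightarrow> bool" where
  "smooth_fun_on M W f \<longleftrightarrow> (\<forall>(U, \<kappa>)\<in>M. smooth_on (\<kappa> ` (U \<inter> W)) (f \<circ> inv_into U \<kappa>))"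

definition smooth_funs :: "('m, 'n::euclidean_space) atlas \<Rightarrow> ('m \<Rightarrow> real) set" where
  "smooth_funs M = {f. smooth_fun_on M UNIV f}"

definition fun_scale :: "('m \<Rightarrow> real) \<Rightarrow> ('m \<Rightarrow> 'v::real_vector) \<Rightarrow> ('m \<Rightarrow> 'v)"
    (infixr \<open>\<odot>\<close> 75) where
  "f \<odot> s = (\<lambda>x. f x *\<^sub>R s x)"

definition smooth_linear_on ::
  "('m, 'n::euclidean_space) atlas \<Rightarrow> ('m \<Rightarrow> 'v::real_vector) set \<Rightarrow>
   (('m \<Rightarrow> 'v) \<Rightarrow> ('m \<Rightarrow> 'w::real_vector)) \<Rightarrow> bool" where
  "smooth_linear_on M S F \<longleftrightarrow>
     (\<forall>s\<in>S. \<forall>t\<in>S. F (s + t) = F s + F t) \<and>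
     (\<forall>f\<in>smooth_funs M. \<forall>s\<in>S. F (f \<odot> s) = f \<odot> F s)"

section \<open>Vector fields and differential forms\<close>

type_synonym 'm tangent = "('m \<Rightarrow> real) \<Rightarrow> real"
type_synonym 'm vector_field = "'m \<Rightarrow> 'm tangent"
type_synonym 'm form1 = "'m vector_field \<Rightarrow> 'm \<Rightarrow> real"
type_synonym 'm form3 = "'m vector_field \<Rightarrow> 'm vector_field \<Rightarrow> 'm vector_field \<Rightarrow> 'm \<Rightarrow> real"

text \<open>
  A tangent vector at \<open>x\<close> is a derivation at \<open>x\<close> of the algebra of smooth functions; it is
  extended by 0 to non-smooth functions, so that it is determined by its mathematical values.
\<close>

definition tangent_space :: "('m, 'n::euclidean_space) atlas \<Rightarrow> 'm \<Rightarrow> 'm tangent set" where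
  "tangent_space M x =
     {d. linear_on (smooth_funs M) d \<and>
         (\<forall>f\<in>smooth_funs M. \<forall>h\<in>smooth_funs M. d (\<lambda>y. f y * h y) = f x * d h + h x * d f) \<and>
         (\<forall>f. f \<notin> smooth_funs M \<longrightarrow> d f = 0)}"

definition cotangent_space ::
  "('m, 'n::euclidean_space) atlas \<Rightarrow> 'm \<Rightarrow> ('m tangent \<Rightarrow> real) set" where
  "cotangent_space M x =
     {\<xi>. linear_on (tangent_space M x) \<xi> \<and> (\<forall>d. d \<notin> tangent_space M x \<longrightarrow> \<xi> d = 0)}"

definition dir_deriv :: "'m vector_field \<Rightarrow> ('m \<Rightarrow> real) \<Rightarrow> ('m \<Rightarrow> real)" where
  "dir_deriv X f = (\<lambda>x. X x f)"

definition vector_fields :: "('m, 'n::euclidean_space) atlas \<Rightarrow> 'm vector_field set" where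
  "vector_fields M =
     {X. (\<forall>x. X x \<in> tangent_space M x) \<and> (\<forall>f\<in>smooth_funs M. dir_deriv X f \<in> smooth_funs M)}"

definition lie_bracket ::
  "('m, 'n::euclidean_space) atlas \<Rightarrow> 'm vector_field \<Rightarrow> 'm vector_field \<Rightarrow> 'm vector_field" where
  "lie_bracket M X Y =
     (\<lambda>x f. if f \<in> smooth_funs M then X x (dir_deriv Y f) - Y x (dir_deriv X f) else 0)"

text \<open>
  Differential forms are given by their evaluation on vector fields, that is, as alternating
  multilinear maps over the algebra of smooth functions.  One-forms are extended by 0 to
  arguments that are not (smooth) vector fields, so that equality of one-forms is equality of
  functions.
\<close>

definition one_forms :: "('m, 'n::euclidean_space) atlas \<Rightarrow> 'm form1 set" where
  "one_forms M =
     {\<xi>. (\<forall>Z\<in>vector_fields M. \<xi> Z \<in> smooth_funs M) \<and>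
         smooth_linear_on M (vector_fields M) \<xi> \<and>
         (\<forall>Z. Z \<notin> vector_fields M \<longrightarrow> \<xi> Z = 0)}"

definition three_form :: "('m, 'n::euclidean_space) atlas \<Rightarrow> 'm form3 \<Rightarrow> bool" where
  "three_form M H \<longleftrightarrow>
     (\<forall>X\<in>vector_fields M. \<forall>Y\<in>vector_fields M.
        (\<forall>Z\<in>vector_fields M. H X Y Z \<in> smooth_funs M) \<and>
        smooth_linear_on M (vector_fields M) (\<lambda>Z. H Z X Y) \<and>
        smooth_linear_on M (vector_fields M) (\<lambda>Z. H X Z Y) \<and>
        smooth_linear_on M (vector_fields M) (\<lambda>Z. H X Y Z) \<and>
        H X X Y = 0 \<and> H X Y Y = 0 \<and> H X Y X = 0)"

definition ext_deriv1 ::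
  "('m, 'n::euclidean_space) atlas \<Rightarrow> 'm form1 \<Rightarrow> 'm vector_field \<Rightarrow> 'm vector_field \<Rightarrow> 'm \<Rightarrow> real" where
  "ext_deriv1 M \<xi> Y Z = dir_deriv Y (\<xi> Z) - dir_deriv Z (\<xi> Y) - \<xi> (lie_bracket M Y Z)"

definition lie_deriv1 ::
  "('m, 'n::euclidean_space) atlas \<Rightarrow> 'm vector_field \<Rightarrow> 'm form1 \<Rightarrow> 'm vector_field \<Rightarrow> 'm \<Rightarrow> real" where
  "lie_deriv1 M X \<zeta> Z = dir_deriv X (\<zeta> Z) - \<zeta> (lie_bracket M X Z)"

definition ext_deriv3 ::
  "('m, 'n::euclidean_space) atlas \<Rightarrow> 'm form3 \<Rightarrow>
   'm vector_field \<Rightarrow> 'm vector_field \<Rightarrow> 'm vector_field \<Rightarrow> 'm vector_field \<Rightarrow> 'm \<Rightarrow> real" where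
  "ext_deriv3 M H W X Y Z =
     dir_deriv W (H X Y Z) - dir_deriv X (H W Y Z) + dir_deriv Y (H W X Z) - dir_deriv Z (H W X Y)
     - H (lie_bracket M W X) Y Z + H (lie_bracket M W Y) X Z - H (lie_bracket M W Z) X Y
     - H (lie_bracket M X Y) W Z + H (lie_bracket M X Z) W Y - H (lie_bracket M Y Z) W X"

definition closed_three_form :: "('m, 'n::euclidean_space) atlas \<Rightarrow> 'm form3 \<Rightarrow> bool" where
  "closed_three_form M H \<longleftrightarrow> three_form M H \<and>
     (\<forall>W\<in>vector_fields M. \<forall>X\<in>vector_fields M. \<forall>Y\<in>vector_fields M. \<forall>Z\<in>vector_fields M.
        ext_deriv3 M H W X Y Z = 0)"

section \<open>Semi-Riemannian metrics and the Levi-Civita connection\<close>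

definition semi_riemannian_metric ::
  "('m, 'n::euclidean_space) atlas \<Rightarrow> ('m \<Rightarrow> 'm tangent \<Rightarrow> 'm tangent \<Rightarrow> real) \<Rightarrow> bool" where
  "semi_riemannian_metric M g \<longleftrightarrow>
     (\<forall>x. scalar_product_on (tangent_space M x) (g x)) \<and>
     (\<forall>X\<in>vector_fields M. \<forall>Y\<in>vector_fields M. (\<lambda>x. g x (X x) (Y x)) \<in> smooth_funs M)"

definition affine_connection ::
  "('m, 'n::euclidean_space) atlas \<Rightarrow>
   ('m vector_field \<Rightarrow> 'm vector_field \<Rightarrow> 'm vector_field) \<Rightarrow> bool" where
  "affine_connection M nab \<longleftrightarrow>
     (\<forall>X\<in>vector_fields M. \<forall>Y\<in>vector_fields M. nab X Y \<in> vector_fields M) \<and>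
     (\<forall>Y\<in>vector_fields M. smooth_linear_on M (vector_fields M) (\<lambda>X. nab X Y)) \<and>
     (\<forall>X\<in>vector_fields M. linear_on (vector_fields M) (nab X)) \<and>
     (\<forall>f\<in>smooth_funs M. \<forall>X\<in>vector_fields M. \<forall>Y\<in>vector_fields M.
        nab X (f \<odot> Y) = dir_deriv X f \<odot> Y + f \<odot> nab X Y)"

definition levi_civita ::
  "('m, 'n::euclidean_space) atlas \<Rightarrow> ('m \<Rightarrow> 'm tangent \<Rightarrow> 'm tangent \<Rightarrow> real) \<Rightarrow>
   ('m vector_field \<Rightarrow> 'm vector_field \<Rightarrow> 'm vector_field) \<Rightarrow> bool" where
  "levi_civita M g nab \<longleftrightarrow> affine_connection M nab \<and>
     (\<forall>X\<in>vector_fields M. \<forall>Y\<in>vector_fields M. nab X Y - nab Y X = lie_bracket M X Y) \<and>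
     (\<forall>X\<in>vector_fields M. \<forall>Y\<in>vector_fields M. \<forall>Z\<in>vector_fields M.
        dir_deriv X (\<lambda>x. g x (Y x) (Z x)) =
        (\<lambda>x. g x (nab X Y x) (Z x) + g x (Y x) (nab X Z x)))"

section \<open>Vector bundles and Courant algebroids\<close>

text \<open>
  The fibres of a vector bundle are realised as subspaces of one ambient, possibly
  infinite-dimensional, vector space \<open>'v\<close> (for instance the direct sum of all fibres).
  No topology of \<open>'v\<close> is involved: the smooth structure is given by the local frames
  \<open>(U, s)\<close>, where \<open>s 0, \<dots>, s (rank - 1)\<close> is a frame over \<open>U\<close>.
\<close>

record ('m, 'v) vector_bundle =
  fibre :: "'m \<Rightarrow> 'v set"
  rank :: nat
  frames :: "('m set \<times> (nat \<Rightarrow> 'm \<Rightarrow> 'v)) set"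

definition smooth_vector_bundle ::
  "('m::topological_space, 'n::euclidean_space) atlas \<Rightarrow>
   ('m, 'v::real_vector, 'z) vector_bundle_scheme \<Rightarrow> bool" where
  "smooth_vector_bundle M E \<longleftrightarrow>
     (\<Union>(U, s)\<in>frames E. U) = UNIV \<and>
     (\<forall>(U, s)\<in>frames E. open U \<and>
        (\<forall>x\<in>U. inj_on (\<lambda>i. s i x) {..<rank E} \<and> independent ((\<lambda>i. s i x) ` {..<rank E}) \<and>
                span ((\<lambda>i. s i x) ` {..<rank E}) = fibre E x)) \<and>
     (\<forall>(U, s)\<in>frames E. \<forall>(V, t)\<in>frames E. \<exists>a. \<forall>i<rank E.
        (\<forall>j<rank E. smooth_fun_on M (U \<inter> V) (a i j)) \<and>
        (\<forall>x\<in>U \<inter> V. s i x = (\<Sum>j<rank E. a i j x *\<^sub>R t j x)))"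

definition sections ::
  "('m, 'n::euclidean_space) atlas \<Rightarrow> ('m, 'v::real_vector, 'z) vector_bundle_scheme \<Rightarrow>
   ('m \<Rightarrow> 'v) set" where
  "sections M E =
     {u. (\<forall>x. u x \<in> fibre E x) \<and>
         (\<forall>(U, s)\<in>frames E. \<exists>c. (\<forall>i<rank E. smooth_fun_on M U (c i)) \<and>
            (\<forall>x\<in>U. u x = (\<Sum>i<rank E. c i x *\<^sub>R s i x)))}"

definition bundle_metric ::
  "('m, 'n::euclidean_space) atlas \<Rightarrow> ('m, 'v::real_vector, 'z) vector_bundle_scheme \<Rightarrow>
   ('m \<Rightarrow> 'v \<Rightarrow> 'v \<Rightarrow> real) \<Rightarrow> bool" where
  "bundle_metric M E b \<longleftrightarrow>
     (\<forall>x. scalar_product_on (fibre E x) (b x)) \<and>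
     (\<forall>u\<in>sections M E. \<forall>v\<in>sections M E. (\<lambda>x. b x (u x) (v x)) \<in> smooth_funs M)"

record ('m, 'v) courant = "('m, 'v) vector_bundle" +
  pairing :: "'m \<Rightarrow> 'v \<Rightarrow> 'v \<Rightarrow> real"
  bracket :: "('m \<Rightarrow> 'v) \<Rightarrow> ('m \<Rightarrow> 'v) \<Rightarrow> ('m \<Rightarrow> 'v)"
  anchor :: "'m \<Rightarrow> 'v \<Rightarrow> 'm tangent"

definition inner_sec :: "('m, 'v) courant \<Rightarrow> ('m \<Rightarrow> 'v) \<Rightarrow> ('m \<Rightarrow> 'v) \<Rightarrow> 'm \<Rightarrow> real" where
  "inner_sec E u v = (\<lambda>x. pairing E x (u x) (v x))"

definition anchor_sec :: "('m, 'v) courant \<Rightarrow> ('m \<Rightarrow> 'v) \<Rightarrow> 'm vector_field" where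
  "anchor_sec E u = (\<lambda>x. anchor E x (u x))"

definition bundle_map_to_tangent ::
  "('m, 'n::euclidean_space) atlas \<Rightarrow> ('m, 'v::real_vector, 'z) vector_bundle_scheme \<Rightarrow>
   ('m \<Rightarrow> 'v \<Rightarrow> 'm tangent) \<Rightarrow> bool" where
  "bundle_map_to_tangent M E a \<longleftrightarrow>
     (\<forall>x. linear_on (fibre E x) (a x) \<and> a x ` fibre E x \<subseteq> tangent_space M x) \<and>
     (\<forall>u\<in>sections M E. (\<lambda>x. a x (u x)) \<in> vector_fields M)"

text \<open>
  The Leibniz rule for the bracket and its compatibility with the anchor follow from these
  axioms.
\<close>

definition courant_algebroid ::
  "('m::topological_space, 'n::euclidean_space) atlas \<Rightarrow> ('m, 'v::real_vector) courant \<Rightarrow> bool" where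
  "courant_algebroid M E \<longleftrightarrow>
     smooth_vector_bundle M E \<and> bundle_metric M E (pairing E) \<and>
     bundle_map_to_tangent M E (anchor E) \<and>
     (\<forall>u\<in>sections M E. \<forall>v\<in>sections M E. bracket E u v \<in> sections M E) \<and>
     (\<forall>u\<in>sections M E. linear_on (sections M E) (bracket E u)) \<and>
     (\<forall>u\<in>sections M E. linear_on (sections M E) (\<lambda>v. bracket E v u)) \<and>
     (\<forall>u\<in>sections M E. \<forall>v\<in>sections M E. \<forall>w\<in>sections M E.
        bracket E u (bracket E v w) = bracket E (bracket E u v) w + bracket E v (bracket E u w) \<and>
        dir_deriv (anchor_sec E u) (inner_sec E v w) =
          inner_sec E (bracket E u v) w + inner_sec E v (bracket E u w) \<and>
        dir_deriv (anchor_sec E u) (inner_sec E v w) =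
          inner_sec E u (bracket E v w + bracket E w v))"

text \<open>
  The inclusion of the cotangent bundle is the dual of the anchor, where \<open>E\<close> is identified with
  its dual by the scalar product.  The factor 1/2 is the one that turns it into the inclusion
  of the second summand of \<open>TM \<oplus> T\<^sup>*M\<close> with its scalar product \<open>(\<xi>(Y) + \<zeta>(X)) / 2\<close>.
\<close>

definition cotangent_incl ::
  "('m, 'v) courant \<Rightarrow> 'm \<Rightarrow> ('m tangent \<Rightarrow> real) \<Rightarrow> 'v" where
  "cotangent_incl E x \<xi> =
     (THE e. e \<in> fibre E x \<and> (\<forall>a\<in>fibre E x. pairing E x e a = \<xi> (anchor E x a) / 2))"

definition cotangent_sub ::
  "('m, 'n::euclidean_space) atlas \<Rightarrow> ('m, 'v) courant \<Rightarrow> 'm \<Rightarrow> 'v set" where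
  "cotangent_sub M E x = cotangent_incl E x ` cotangent_space M x"

definition exact_courant_algebroid ::
  "('m::topological_space, 'n::euclidean_space) atlas \<Rightarrow> ('m, 'v::real_vector) courant \<Rightarrow> bool" where
  "exact_courant_algebroid M E \<longleftrightarrow> courant_algebroid M E \<and>
     (\<forall>x. inj_on (cotangent_incl E x) (cotangent_space M x) \<and>
          cotangent_sub M E x = {e \<in> fibre E x. anchor E x e = 0} \<and>
          anchor E x ` fibre E x = tangent_space M x)"

section \<open>Generalised metrics\<close>

definition metric_End ::
  "('m, 'v) courant \<Rightarrow> ('m \<Rightarrow> 'v \<Rightarrow> 'v \<Rightarrow> real) \<Rightarrow> 'm \<Rightarrow> 'v \<Rightarrow> 'v" where
  "metric_End E G x e =
     (THE a. a \<in> fibre E x \<and> (\<forall>b\<in>fibre E x. pairing E x a b = G x e b))"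

definition generalised_metric ::
  "('m, 'n::euclidean_space) atlas \<Rightarrow> ('m, 'v::real_vector) courant \<Rightarrow>
   ('m \<Rightarrow> 'v \<Rightarrow> 'v \<Rightarrow> real) \<Rightarrow> bool" where
  "generalised_metric M E G \<longleftrightarrow> bundle_metric M E G \<and>
     (\<forall>x. (\<forall>e\<in>fibre E x. metric_End E G x (metric_End E G x e) = e) \<and>
          nondegenerate_on (cotangent_sub M E x) (G x))"

text \<open>The sign \<open>\<epsilon>\<close> is 1 or -1 throughout: \<open>eigen_fibre E G \<epsilon>\<close> is \<open>E\<^sub>+\<close> for 1 and \<open>E\<^sub>-\<close> for -1.\<close>

definition eigen_fibre ::
  "('m, 'v::real_vector) courant \<Rightarrow> ('m \<Rightarrow> 'v \<Rightarrow> 'v \<Rightarrow> real) \<Rightarrow> real \<Rightarrow> 'm \<Rightarrow> 'v set" where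
  "eigen_fibre E G \<epsilon> x = {e \<in> fibre E x. metric_End E G x e = \<epsilon> *\<^sub>R e}"

definition eigen_sections ::
  "('m, 'n::euclidean_space) atlas \<Rightarrow> ('m, 'v::real_vector) courant \<Rightarrow>
   ('m \<Rightarrow> 'v \<Rightarrow> 'v \<Rightarrow> real) \<Rightarrow> real \<Rightarrow> ('m \<Rightarrow> 'v) set" where
  "eigen_sections M E G \<epsilon> = {u \<in> sections M E. \<forall>x. u x \<in> eigen_fibre E G \<epsilon> x}"

definition eigen_proj ::
  "('m, 'v::real_vector) courant \<Rightarrow> ('m \<Rightarrow> 'v \<Rightarrow> 'v \<Rightarrow> real) \<Rightarrow> real \<Rightarrow> ('m \<Rightarrow> 'v) \<Rightarrow> ('m \<Rightarrow> 'v)" where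
  "eigen_proj E G \<epsilon> u =
     (\<lambda>x. THE a. a \<in> eigen_fibre E G \<epsilon> x \<and> u x - a \<in> eigen_fibre E G (-\<epsilon>) x)"

definition metric_of_generalised_metric ::
  "('m, 'n::euclidean_space) atlas \<Rightarrow> ('m, 'v::real_vector) courant \<Rightarrow>
   ('m \<Rightarrow> 'v \<Rightarrow> 'v \<Rightarrow> real) \<Rightarrow> ('m \<Rightarrow> 'm tangent \<Rightarrow> 'm tangent \<Rightarrow> real) \<Rightarrow> bool" where
  "metric_of_generalised_metric M E G g \<longleftrightarrow> semi_riemannian_metric M g \<and>
     (\<forall>\<epsilon>\<in>{1, -1}. \<forall>x. \<forall>a\<in>eigen_fibre E G \<epsilon> x. \<forall>b\<in>eigen_fibre E G \<epsilon> x.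
        g x (anchor E x a) (anchor E x b) = G x a b)"

section \<open>The twisted Courant algebroid on the generalised tangent bundle\<close>

type_synonym 'm gen_field = "'m vector_field \<times> 'm form1"

definition gtb_pairing :: "'m gen_field \<Rightarrow> 'm gen_field \<Rightarrow> 'm \<Rightarrow> real" where
  "gtb_pairing = (\<lambda>(X, \<xi>) (Y, \<zeta>) x. (\<xi> Y x + \<zeta> X x) / 2)"

definition gtb_bracket ::
  "('m, 'n::euclidean_space) atlas \<Rightarrow> 'm form3 \<Rightarrow> 'm gen_field \<Rightarrow> 'm gen_field \<Rightarrow> 'm gen_field" where
  "gtb_bracket M H = (\<lambda>(X, \<xi>) (Y, \<zeta>).
     (lie_bracket M X Y,
      \<lambda>Z. if Z \<in> vector_fields M
          then lie_deriv1 M X \<zeta> Z - ext_deriv1 M \<xi> Y Z + H X Y Z else 0))"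

text \<open>The map \<open>(1 \<plusminus> g) \<circ> \<pi>\<^sub>\<plusminus>\<close> on \<open>E\<^sub>\<plusminus>\<close>, on sections.\<close>

definition phi ::
  "('m, 'n::euclidean_space) atlas \<Rightarrow> ('m, 'v::real_vector) courant \<Rightarrow>
   ('m \<Rightarrow> 'v \<Rightarrow> 'v \<Rightarrow> real) \<Rightarrow> ('m \<Rightarrow> 'm tangent \<Rightarrow> 'm tangent \<Rightarrow> real) \<Rightarrow>
   ('m \<Rightarrow> 'v) \<Rightarrow> 'm gen_field" where
  "phi M E G g u =
     (let X = anchor_sec E (eigen_proj E G 1 u); Y = anchor_sec E (eigen_proj E G (-1) u)
      in (X + Y, \<lambda>Z. if Z \<in> vector_fields M
                     then (\<lambda>x. g x (X x) (Z x) - g x (Y x) (Z x)) else 0))"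

text \<open>
  Isomorphisms of vector bundles over the identity are isomorphisms of the modules of sections.
\<close>

definition courant_isomorphism ::
  "('m, 'n::euclidean_space) atlas \<Rightarrow> ('m, 'v::real_vector) courant \<Rightarrow> 'm form3 \<Rightarrow>
   (('m \<Rightarrow> 'v) \<Rightarrow> 'm gen_field) \<Rightarrow> bool" where
  "courant_isomorphism M E H \<phi> \<longleftrightarrow>
     bij_betw \<phi> (sections M E) (vector_fields M \<times> one_forms M) \<and>
     (\<forall>u\<in>sections M E. \<forall>v\<in>sections M E.
        \<phi> (u + v) = (fst (\<phi> u) + fst (\<phi> v), snd (\<phi> u) + snd (\<phi> v))) \<and>
     (\<forall>f\<in>smooth_funs M. \<forall>u\<in>sections M E.
        \<phi> (f \<odot> u) = (f \<odot> fst (\<phi> u), \<lambda>Z. f \<odot> snd (\<phi> u) Z)) \<and>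
     (\<forall>u\<in>sections M E. fst (\<phi> u) = anchor_sec E u) \<and>
     (\<forall>u\<in>sections M E. \<forall>v\<in>sections M E. gtb_pairing (\<phi> u) (\<phi> v) = inner_sec E u v) \<and>
     (\<forall>u\<in>sections M E. \<forall>v\<in>sections M E. \<phi> (bracket E u v) = gtb_bracket M H (\<phi> u) (\<phi> v))"

section \<open>Generalised connections\<close>

type_synonym ('m, 'v) gen_conn = "('m \<Rightarrow> 'v) \<Rightarrow> ('m \<Rightarrow> 'v) \<Rightarrow> ('m \<Rightarrow> 'v)"

definition generalised_connection ::
  "('m, 'n::euclidean_space) atlas \<Rightarrow> ('m, 'v::real_vector) courant \<Rightarrow> ('m, 'v) gen_conn \<Rightarrow> bool" where
  "generalised_connection M E D \<longleftrightarrow>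
     (\<forall>u\<in>sections M E. \<forall>v\<in>sections M E. D u v \<in> sections M E) \<and>
     (\<forall>v\<in>sections M E. smooth_linear_on M (sections M E) (\<lambda>u. D u v)) \<and>
     (\<forall>u\<in>sections M E. linear_on (sections M E) (D u)) \<and>
     (\<forall>f\<in>smooth_funs M. \<forall>u\<in>sections M E. \<forall>v\<in>sections M E.
        D u (f \<odot> v) = dir_deriv (anchor_sec E u) f \<odot> v + f \<odot> D u v) \<and>
     (\<forall>u\<in>sections M E. \<forall>v\<in>sections M E. \<forall>w\<in>sections M E.
        dir_deriv (anchor_sec E u) (inner_sec E v w) =
          inner_sec E (D u v) w + inner_sec E v (D u w))"

definition gen_torsion ::
  "('m, 'v::real_vector) courant \<Rightarrow> ('m, 'v) gen_conn \<Rightarrow>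
   ('m \<Rightarrow> 'v) \<Rightarrow> ('m \<Rightarrow> 'v) \<Rightarrow> ('m \<Rightarrow> 'v) \<Rightarrow> 'm \<Rightarrow> real" where
  "gen_torsion E D u v w =
     inner_sec E (D u v - D v u - bracket E u v) w + inner_sec E (D w u) v"

definition is_D_tilde ::
  "('m, 'n::euclidean_space) atlas \<Rightarrow> ('m, 'v::real_vector) courant \<Rightarrow>
   ('m \<Rightarrow> 'v \<Rightarrow> 'v \<Rightarrow> real) \<Rightarrow> ('m vector_field \<Rightarrow> 'm vector_field \<Rightarrow> 'm vector_field) \<Rightarrow>
   ('m, 'v) gen_conn \<Rightarrow> bool" where
  "is_D_tilde M E G nab Dt \<longleftrightarrow> generalised_connection M E Dt \<and>
     (\<forall>\<epsilon>\<in>{1, -1}. \<forall>u\<in>eigen_sections M E G \<epsilon>.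
        (\<forall>v\<in>eigen_sections M E G \<epsilon>.
           Dt u v = (\<lambda>x. inv_into (eigen_fibre E G \<epsilon> x) (anchor E x)
                           (nab (anchor_sec E u) (anchor_sec E v) x))) \<and>
        (\<forall>v\<in>eigen_sections M E G (-\<epsilon>). Dt u v = eigen_proj E G (-\<epsilon>) (bracket E u v)))"

definition canonical_connection ::
  "('m, 'n::euclidean_space) atlas \<Rightarrow> ('m, 'v::real_vector) courant \<Rightarrow>
   ('m, 'v) gen_conn \<Rightarrow> ('m, 'v) gen_conn \<Rightarrow> bool" where
  "canonical_connection M E Dt D \<longleftrightarrow> generalised_connection M E D \<and>
     (\<forall>u\<in>sections M E. \<forall>v\<in>sections M E. \<forall>w\<in>sections M E. \<forall>x.
        inner_sec E (D u v) w x = inner_sec E (Dt u v) w x - gen_torsion E Dt u v w x / 3)"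

definition constant_products ::
  "('m, 'v) courant \<Rightarrow> ('m \<Rightarrow> 'v) \<Rightarrow> ('m \<Rightarrow> 'v) \<Rightarrow> ('m \<Rightarrow> 'v) \<Rightarrow> bool" where
  "constant_products E u v w \<longleftrightarrow>
     (\<forall>(a, b)\<in>{(u, v), (u, w), (v, w)}. \<exists>c. \<forall>x. inner_sec E a b x = c)"

definition pullback3 ::
  "('m, 'v) courant \<Rightarrow> 'm form3 \<Rightarrow> ('m \<Rightarrow> 'v) \<Rightarrow> ('m \<Rightarrow> 'v) \<Rightarrow> ('m \<Rightarrow> 'v) \<Rightarrow> 'm \<Rightarrow> real" where
  "pullback3 E H u v w = H (anchor_sec E u) (anchor_sec E v) (anchor_sec E w)"

definition conn_coeff ::
  "('m, 'v) courant \<Rightarrow> ('m \<Rightarrow> 'm tangent \<Rightarrow> 'm tangent \<Rightarrow> real) \<Rightarrow>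
   ('m vector_field \<Rightarrow> 'm vector_field \<Rightarrow> 'm vector_field) \<Rightarrow>
   ('m \<Rightarrow> 'v) \<Rightarrow> ('m \<Rightarrow> 'v) \<Rightarrow> ('m \<Rightarrow> 'v) \<Rightarrow> 'm \<Rightarrow> real" where
  "conn_coeff E g nab u v w =
     (\<lambda>x. g x (nab (anchor_sec E u) (anchor_sec E v) x) (anchor_sec E w x))"

end

theory Submission
  imports Defs
begin

text \<open>
  Everything rests on one formula.  Under \<open>\<phi>\<close>, sections of \<open>E\<^sub>\<plusminus>\<close> become \<open>X \<plusminus> gX\<close>, so that the twisted
  Dorfman bracket of such sections only involves derivatives of \<open>g\<close>, Lie brackets and \<open>H\<close>; since
  \<open>\<nabla>\<close> is metric and torsion-free, for \<open>u, v, w\<close> in the eigenbundles of signs \<open>a, b, c\<close> one gets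

  \<open>2 \<langle>[u, v], w\<rangle> = (b + c) \<Gamma>(u, v, w) - (a + c) \<Gamma>(v, u, w) + (a + b) \<Gamma>(w, u, v) + (\<pi>\<^sup>*H)(u, v, w)\<close>,

  which is \<open>inner_bracket\<close>.

  If all signs equal \<open>\<epsilon>\<close>, then \<open>\<langle>Dt u v, w\<rangle> = \<epsilon> \<Gamma>(u, v, w)\<close>; in the torsion of \<open>Dt\<close> the three
  \<open>\<Gamma>\<close>-terms cancel against those of the bracket, which leaves \<open>- \<pi>\<^sup>*H / 2\<close>, and the correction by a
  third of it contributes \<open>\<pi>\<^sup>*H / 6\<close>.  If \<open>u\<close> has sign \<open>\<epsilon>\<close> and \<open>v, w\<close> have sign \<open>-\<epsilon>\<close>, then
  \<open>\<langle>Dt u v, w\<rangle> = \<langle>[u, v], w\<rangle>\<close>, and all terms of the torsion cancel or vanish because the eigenbundles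
  are orthogonal; so the coefficient is that of the bracket, where the signs leave only
  \<open>\<pi>\<^sup>*H / 2 - \<epsilon> \<Gamma>(u, v, w)\<close>.

  The definitions of \<open>Dt\<close> and \<open>\<phi>\<close> invert \<open>\<pi>\<close> on \<open>E\<^sub>\<plusminus>\<close> and project onto \<open>E\<^sub>\<plusminus>\<close>.  That this makes sense
  is linear algebra in the fibres: a nondegenerate form represents linear functionals
  (\<open>nondegenerate_form_represents\<close>), the fibre is the sum of the two eigenspaces
  (\<open>eig_decomposition\<close>), and \<open>\<pi>\<close> maps each of them onto the tangent space (\<open>anchor_eig_surj\<close>).
\<close>

section \<open>Nondegenerate forms on finite-dimensional subspaces\<close>

lemma linear_on_add: "linear_on V f \<Longrightarrow> a \<in> V \<Longrightarrow> b \<in> V \<Longrightarrow> f (a + b) = f a + f b"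
  and linear_on_scale: "linear_on V f \<Longrightarrow> a \<in> V \<Longrightarrow> f (c *\<^sub>R a) = c *\<^sub>R f a"
  by (simp_all add: linear_on_def)

lemma linear_on_zero: "subspace V \<Longrightarrow> linear_on V f \<Longrightarrow> f 0 = 0"
  using linear_on_scale[of V f 0 0] by (simp add: subspace_0)

lemma linear_on_diff:
  assumes "subspace V" "linear_on V f" "a \<in> V" "b \<in> V"
  shows "f (a - b) = f a - f b"
proof -
  have "f (a + (-1) *\<^sub>R b) = f a + f ((-1) *\<^sub>R b)"
    using assms by (intro linear_on_add subspace_scale)
  then show ?thesis
    using linear_on_scale[OF assms(2,4), of "-1"] by simp
qed

lemma linear_on_subset: "linear_on V f \<Longrightarrow> W \<subseteq> V \<Longrightarrow> linear_on W f"
  unfolding linear_on_def by blast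

lemma linear_on_eq_span:
  assumes V: "subspace V" and C: "C \<subseteq> V" "V \<subseteq> span C"
    and f: "linear_on V f" and h: "linear_on V h"
    and eq: "\<And>c. c \<in> C \<Longrightarrow> f c = h c" and a: "a \<in> V"
  shows "f a = h a"
proof -
  have "a \<in> span C" using a C by blast
  then have "a \<in> V \<and> f a = h a"
  proof (induction rule: span_induct_alt)
    case base
    show ?case using V f h by (simp add: linear_on_zero subspace_0)
  next
    case (step c e b)
    then have "e \<in> V" using C by blast
    then have "c *\<^sub>R e \<in> V" using V by (simp add: subspace_scale)
    moreover have "f (c *\<^sub>R e) = h (c *\<^sub>R e)"
      using f h eq[OF step(1)] \<open>e \<in> V\<close> by (simp add: linear_on_scale)
    ultimately show ?case
      using step V f h by (simp add: linear_on_add subspace_add)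
  qed
  then show ?thesis ..
qed

text \<open>
  A nondegenerate form embeds the space injectively into its dual; both have the same dimension.
  In a basis \<open>C\<close>, the dual is the space of functions supported on \<open>C\<close>.
\<close>

lemma nondegenerate_form_represents:
  fixes V :: "'a::real_vector set" and b :: "'a \<Rightarrow> 'a \<Rightarrow> real"
  assumes V: "subspace V" and fin: "finite B" "V \<subseteq> span B"
    and b: "scalar_product_on V b" and f: "linear_on V f"
  shows "\<exists>!e. e \<in> V \<and> (\<forall>a\<in>V. b e a = f a)"
proof (rule ex_ex1I)
  have lin: "linear_on V (b a)" "linear_on V (\<lambda>c. b c a)" if "a \<in> V" for a
    using b that by (auto simp: scalar_product_on_def)
  have nondeg: "a = 0" if "a \<in> V" "\<forall>c\<in>V. b a c = 0" for a
    using b that by (auto simp: scalar_product_on_def nondegenerate_on_def)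
  obtain C where C: "C \<subseteq> V" "independent C" "V \<subseteq> span C"
    using real_vector.maximal_independent_subset by blast
  have finC: "finite C"
    using real_vector.independent_span_bound[OF fin(1) C(2)] C(1) fin(2) by blast
  have spanC: "span C = V"
    using C V by (simp add: span_minimal subset_antisym)
  define r :: "('a \<Rightarrow> real) \<Rightarrow> 'a \<Rightarrow> real" where "r h = (\<lambda>i. if i \<in> C then h i else 0)" for h
  obtain L where L: "linear L" "\<forall>c\<in>C. L c = r (b c)"
    using linear_independent_extend[OF C(2), of "\<lambda>c. r (b c)"] by blast
  have lin_L: "linear_on V L" "linear_on V (\<lambda>e. r (b e))"
    using L(1) lin C(1)
    by (auto simp: linear_on_def linear_add linear_scale r_def fun_eq_iff scaleR_fun_def subset_eq)
  have L_eq: "L e = r (b e)" if "e \<in> V" for e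
    using linear_on_eq_span[OF V C(1,3) lin_L] L(2) that by blast
  have inj: "inj_on L V"
  proof (rule inj_onI)
    fix x y assume xy: "x \<in> V" "y \<in> V" "L x = L y"
    then have d: "x - y \<in> V" using V by (simp add: subspace_diff)
    have eqC: "b x c = b y c" if "c \<in> C" for c
      using xy L_eq that by (metis r_def)
    have "b x c = b y c" if "c \<in> V" for c
      by (rule linear_on_eq_span[OF V C(1,3) lin(1)[OF xy(1)] lin(1)[OF xy(2)] eqC that])
    then have "\<forall>c\<in>V. b (x - y) c = 0"
      using linear_on_diff[OF V lin(2) xy(1,2)] by simp
    then show "x = y" using nondeg[OF d] by simp
  qed
  have ind: "independent (L ` C)"
    using L(1) C(2) inj spanC by (simp add: linear_independent_injective_image)
  define D where "D = (\<lambda>c. r (\<lambda>i. if i = c then 1 else 0)) ` C"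
  have D: "finite D" "card D \<le> card C"
    using finC by (auto simp: D_def card_image_le)
  have spanD: "r h \<in> span D" for h
  proof -
    have "r h = (\<Sum>c\<in>C. h c *\<^sub>R r (\<lambda>i. if i = c then 1 else 0))"
    proof
      fix i
      have "(\<Sum>c\<in>C. h c *\<^sub>R r (\<lambda>i. if i = c then 1 else 0)) i
          = (\<Sum>c\<in>C. (h c *\<^sub>R r (\<lambda>i. if i = c then 1 else 0)) i)"
        by (induction C rule: infinite_finite_induct) auto
      also have "\<dots> = (\<Sum>c\<in>C. if c = i then r h i else 0)"
        by (rule sum.cong) (auto simp: r_def scaleR_fun_def)
      also have "\<dots> = r h i"
        using finC by (simp add: r_def)
      finally show "r h i = (\<Sum>c\<in>C. h c *\<^sub>R r (\<lambda>i. if i = c then 1 else 0)) i" ..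
    qed
    also have "\<dots> \<in> span D"
      by (intro span_sum span_scale span_base) (auto simp: D_def)
    finally show ?thesis .
  qed
  have sub: "L ` C \<subseteq> span D"
    using L(2) spanD by auto
  \<comment> \<open>Otherwise the span of \<open>D\<close> would contain more than \<open>card D\<close> independent elements.\<close>
  have "r f \<in> span (L ` C)"
  proof (rule ccontr)
    assume n: "r f \<notin> span (L ` C)"
    then have "independent (insert (r f) (L ` C))"
      using ind by (simp add: independent_insert)
    then have "card (insert (r f) (L ` C)) \<le> card D"
      using real_vector.independent_span_bound[OF D(1), of "insert (r f) (L ` C)"] sub spanD[of f]
      by simp
    moreover have "r f \<notin> L ` C" using n by (rule contra_subsetD[OF span_superset])
    moreover have "card (L ` C) = card C"
      using inj C(1) by (meson card_image inj_on_subset)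
    ultimately show False using D(2) finC by simp
  qed
  then have "r f \<in> L ` V"
    using linear_span_image[OF L(1)] spanC by metis
  then obtain e where e: "e \<in> V" "r f = r (b e)"
    using L_eq by auto
  then have eqC: "b e c = f c" if "c \<in> C" for c
    using that by (metis r_def)
  have "\<forall>a\<in>V. b e a = f a"
    using linear_on_eq_span[OF V C(1,3) lin(1)[OF e(1)] f eqC] by blast
  then show "\<exists>e. e \<in> V \<and> (\<forall>a\<in>V. b e a = f a)" using e by blast
next
  have lin: "linear_on V (\<lambda>c. b c a)" if "a \<in> V" for a
    using b that by (auto simp: scalar_product_on_def)
  fix x y assume *: "x \<in> V \<and> (\<forall>a\<in>V. b x a = f a)" "y \<in> V \<and> (\<forall>a\<in>V. b y a = f a)"
  then have "\<forall>a\<in>V. b (x - y) a = 0"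
    using linear_on_diff[OF V lin] by auto
  moreover have "x - y \<in> V" using * V by (simp add: subspace_diff)
  ultimately show "x = y"
    using b by (auto simp: scalar_product_on_def nondegenerate_on_def)
qed

section \<open>Tangent and cotangent spaces\<close>

lemma subspace_tangent_space: "subspace (tangent_space M x)"
  unfolding subspace_def tangent_space_def
  by (auto simp: linear_on_def scaleR_fun_def algebra_simps)

text \<open>A nonzero vector is part of a Hamel basis, on which a linear functional can be prescribed.\<close>

lemma cotangent_separates:
  assumes "d \<in> tangent_space M x" "d \<noteq> 0"
  obtains \<xi> where "\<xi> \<in> cotangent_space M x" "\<xi> d \<noteq> 0"
proof -
  obtain h :: "'a tangent \<Rightarrow> real" where h: "linear h" "h d = 1"
    using linear_independent_extend[of "{d}" "\<lambda>_. 1"] assms(2) by auto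
  let ?\<xi> = "\<lambda>e. if e \<in> tangent_space M x then h e else 0"
  have "?\<xi> \<in> cotangent_space M x"
    using h(1) subspace_tangent_space[of M x]
    by (auto simp: cotangent_space_def linear_on_def linear_add linear_scale
          subspace_add subspace_scale)
  moreover have "?\<xi> d \<noteq> 0" using h(2) assms(1) by simp
  ultimately show ?thesis by (rule that)
qed

section \<open>The eigenbundles of a generalised metric\<close>

locale exact_courant_with_metric =
  fixes M :: "('m::topological_space, 'n::euclidean_space) atlas"
    and E :: "('m, 'v::real_vector) courant"
    and G :: "'m \<Rightarrow> 'v \<Rightarrow> 'v \<Rightarrow> real"
  assumes exact: "exact_courant_algebroid M E"
    and gen_metric: "generalised_metric M E G"
begin

abbreviation "J \<equiv> metric_End E G"
abbreviation "eig \<equiv> eigen_fibre E G"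
abbreviation "ker x \<equiv> {e \<in> fibre E x. anchor E x e = 0}"

lemma courant: "courant_algebroid M E"
  using exact by (simp add: exact_courant_algebroid_def)

lemma fibre_span: "\<exists>B. finite B \<and> fibre E x = span B"
proof -
  have svb: "smooth_vector_bundle M E"
    using courant by (simp add: courant_algebroid_def)
  then have "x \<in> (\<Union>(U, s)\<in>frames E. U)"
    by (simp add: smooth_vector_bundle_def)
  then obtain U s where Us: "(U, s) \<in> frames E" "x \<in> U" by auto
  have "\<forall>(U, s)\<in>frames E. \<forall>x\<in>U. span ((\<lambda>i. s i x) ` {..<rank E}) = fibre E x"
    using svb by (simp add: smooth_vector_bundle_def case_prod_beta)
  then have "span ((\<lambda>i. s i x) ` {..<rank E}) = fibre E x"
    using Us by fastforce
  then show ?thesis by (intro exI[of _ "(\<lambda>i. s i x) ` {..<rank E}"]) simp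
qed

lemma subspace_fibre: "subspace (fibre E x)"
  using fibre_span[of x] by (elim exE conjE) simp

lemma pairing_scalar: "scalar_product_on (fibre E x) (pairing E x)"
  using courant by (simp add: courant_algebroid_def bundle_metric_def)

lemma metric_scalar: "scalar_product_on (fibre E x) (G x)"
  using gen_metric by (simp add: generalised_metric_def bundle_metric_def)

lemma pairing_lin:
  assumes "a \<in> fibre E x"
  shows "linear_on (fibre E x) (pairing E x a)" "linear_on (fibre E x) (\<lambda>c. pairing E x c a)"
  using pairing_scalar[of x] assms by (auto simp: scalar_product_on_def)

lemma metric_lin:
  assumes "a \<in> fibre E x"
  shows "linear_on (fibre E x) (G x a)" "linear_on (fibre E x) (\<lambda>c. G x c a)"
  using metric_scalar[of x] assms by (auto simp: scalar_product_on_def)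

lemma pairing_sym: "a \<in> fibre E x \<Longrightarrow> b \<in> fibre E x \<Longrightarrow> pairing E x a b = pairing E x b a"
  using pairing_scalar[of x] by (auto simp: scalar_product_on_def)

lemma metric_sym: "a \<in> fibre E x \<Longrightarrow> b \<in> fibre E x \<Longrightarrow> G x a b = G x b a"
  using metric_scalar[of x] by (auto simp: scalar_product_on_def)

lemma anchor_lin: "linear_on (fibre E x) (anchor E x)"
  and anchor_tangent: "a \<in> fibre E x \<Longrightarrow> anchor E x a \<in> tangent_space M x"
  using courant by (auto simp: courant_algebroid_def bundle_map_to_tangent_def)

lemma represents:
  assumes "linear_on (fibre E x) f"
  shows "\<exists>!e. e \<in> fibre E x \<and> (\<forall>a\<in>fibre E x. pairing E x e a = f a)"
proof -
  obtain B where B: "finite B" "fibre E x = span B" using fibre_span[of x] by (elim exE conjE)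
  show ?thesis
    by (rule nondegenerate_form_represents[OF subspace_fibre B(1) _ pairing_scalar assms])
      (simp add: B(2))
qed

lemma J_fibre: "e \<in> fibre E x \<Longrightarrow> J x e \<in> fibre E x"
  and pairing_J: "e \<in> fibre E x \<Longrightarrow> b \<in> fibre E x \<Longrightarrow> pairing E x (J x e) b = G x e b"
  using theI'[OF represents[OF metric_lin(1)[of e x]]] by (simp_all add: metric_End_def)

lemma J_eqI:
  assumes "e \<in> fibre E x" "a \<in> fibre E x" "\<And>b. b \<in> fibre E x \<Longrightarrow> pairing E x a b = G x e b"
  shows "J x e = a"
  unfolding metric_End_def
  by (rule the1_equality[OF represents[OF metric_lin(1)[OF assms(1)]]]) (use assms in auto)

lemma J_J: "e \<in> fibre E x \<Longrightarrow> J x (J x e) = e"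
  using gen_metric by (simp add: generalised_metric_def)

lemma J_lin: "linear_on (fibre E x) (J x)"
  unfolding linear_on_def
  by (auto intro!: J_eqI
      simp: subspace_fibre subspace_add subspace_scale J_fibre pairing_J
        linear_on_add[OF pairing_lin(2)] linear_on_scale[OF pairing_lin(2)]
        linear_on_add[OF metric_lin(2)] linear_on_scale[OF metric_lin(2)])

lemma eig_fibre: "a \<in> eig \<epsilon> x \<Longrightarrow> a \<in> fibre E x"
  by (simp add: eigen_fibre_def)

lemma subspace_eig: "subspace (eig \<epsilon> x)"
  unfolding subspace_def eigen_fibre_def
  using subspace_fibre[of x] linear_on_zero[OF subspace_fibre J_lin]
    linear_on_add[OF J_lin] linear_on_scale[OF J_lin]
  by (auto simp: subspace_0 subspace_add subspace_scale algebra_simps)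

lemma metric_eig:
  "a \<in> eig \<epsilon> x \<Longrightarrow> b \<in> fibre E x \<Longrightarrow> G x a b = \<epsilon> * pairing E x a b"
  using pairing_J[of a x b] linear_on_scale[OF pairing_lin(2)[of b x], of a \<epsilon>]
  by (simp add: eigen_fibre_def)

lemma eig_orthogonal:
  assumes "\<epsilon> \<noteq> 0" "a \<in> eig \<epsilon> x" "b \<in> eig (-\<epsilon>) x"
  shows "pairing E x a b = 0"
proof -
  have ab: "a \<in> fibre E x" "b \<in> fibre E x" using assms eig_fibre by auto
  have "\<epsilon> * pairing E x a b = - \<epsilon> * pairing E x a b"
    using metric_eig[OF assms(2) ab(2)] metric_eig[OF assms(3) ab(1)]
      metric_sym[OF ab] pairing_sym[OF ab] by simp
  then show ?thesis using assms(1) by simp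
qed

text \<open>As \<open>J\<close> is an involution, \<open>(1 \<plusminus> J) / 2\<close> are the projections onto the eigenspaces.\<close>

lemma add_J_eig:
  assumes "\<epsilon> \<in> {1, -1}" "e \<in> fibre E x"
  shows "e + \<epsilon> *\<^sub>R J x e \<in> eig \<epsilon> x"
proof -
  have m: "\<epsilon> *\<^sub>R J x e \<in> fibre E x"
    using assms by (simp add: J_fibre subspace_fibre subspace_scale)
  have "J x (e + \<epsilon> *\<^sub>R J x e) = J x e + \<epsilon> *\<^sub>R e"
    using assms m by (simp add: linear_on_add[OF J_lin] linear_on_scale[OF J_lin] J_fibre J_J)
  moreover have "\<epsilon> *\<^sub>R (e + \<epsilon> *\<^sub>R J x e) = J x e + \<epsilon> *\<^sub>R e"
    using assms(1) by auto
  ultimately show ?thesis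
    using assms m by (simp add: eigen_fibre_def subspace_fibre subspace_add)
qed

lemma eig_decomposition:
  assumes \<epsilon>: "\<epsilon> \<in> {1, -1}" and e: "e \<in> fibre E x"
  shows "\<exists>!a. a \<in> eig \<epsilon> x \<and> e - a \<in> eig (-\<epsilon>) x"
proof (rule ex_ex1I)
  let ?a = "(1/2) *\<^sub>R (e + \<epsilon> *\<^sub>R J x e)"
  have eq: "e - ?a = (1/2) *\<^sub>R (e + (-\<epsilon>) *\<^sub>R J x e)"
    using scaleR_half_double[of e] by (simp add: algebra_simps)
  have "?a \<in> eig \<epsilon> x" "(1/2) *\<^sub>R (e + (-\<epsilon>) *\<^sub>R J x e) \<in> eig (-\<epsilon>) x"
    using add_J_eig[of \<epsilon> e x] add_J_eig[of "-\<epsilon>" e x] \<epsilon> e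
    by (auto intro!: subspace_scale subspace_eig)
  then show "\<exists>a. a \<in> eig \<epsilon> x \<and> e - a \<in> eig (-\<epsilon>) x"
    using eq by metis
next
  fix a b assume *: "a \<in> eig \<epsilon> x \<and> e - a \<in> eig (-\<epsilon>) x" "b \<in> eig \<epsilon> x \<and> e - b \<in> eig (-\<epsilon>) x"
  have "a - b \<in> eig \<epsilon> x" using * by (simp add: subspace_diff subspace_eig)
  moreover have "a - b \<in> eig (-\<epsilon>) x"
    using * subspace_diff[OF subspace_eig, of "e - b" "-\<epsilon>" x "e - a"] by simp
  ultimately have "\<epsilon> *\<^sub>R (a - b) = (-\<epsilon>) *\<^sub>R (a - b)"
    unfolding eigen_fibre_def by (metis (mono_tags, lifting) mem_Collect_eq)
  then have "2 *\<^sub>R (\<epsilon> *\<^sub>R (a - b)) = 0"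
    unfolding scaleR_2 by (metis add.right_inverse scaleR_minus_left)
  then show "a = b" using \<epsilon> by auto
qed

lemma eigen_proj_eqI:
  assumes "\<epsilon> \<in> {1, -1}" "\<And>x. u x \<in> fibre E x" "\<And>x. a x \<in> eig \<epsilon> x" "\<And>x. u x - a x \<in> eig (-\<epsilon>) x"
  shows "eigen_proj E G \<epsilon> u = a"
  unfolding eigen_proj_def
  by (rule ext, rule the1_equality[OF eig_decomposition]) (use assms in auto)

lemma eigen_proj_eig:
  assumes "\<epsilon> \<in> {1, -1}" "u x \<in> fibre E x"
  shows "eigen_proj E G \<epsilon> u x \<in> eig \<epsilon> x" "u x - eigen_proj E G \<epsilon> u x \<in> eig (-\<epsilon>) x"
  using theI'[OF eig_decomposition[OF assms]] by (auto simp: eigen_proj_def)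

lemma cotangent_incl_fibre:
  assumes "\<xi> \<in> cotangent_space M x"
  shows "cotangent_incl E x \<xi> \<in> fibre E x"
    and "a \<in> fibre E x \<Longrightarrow> pairing E x (cotangent_incl E x \<xi>) a = \<xi> (anchor E x a) / 2"
proof -
  have "linear_on (fibre E x) (\<lambda>a. \<xi> (anchor E x a) / 2)"
    using assms anchor_lin[of x] anchor_tangent[of _ x]
    by (auto simp: cotangent_space_def linear_on_def add_divide_distrib)
  note incl = theI'[OF represents[OF this], folded cotangent_incl_def]
  show "cotangent_incl E x \<xi> \<in> fibre E x"
    using incl by (rule conjunct1)
  show "a \<in> fibre E x \<Longrightarrow> pairing E x (cotangent_incl E x \<xi>) a = \<xi> (anchor E x a) / 2"
    by (rule bspec[OF conjunct2[OF incl]])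
qed

lemma cotangent_sub_ker: "cotangent_sub M E x = ker x"
  using exact by (simp add: exact_courant_algebroid_def)

text \<open>
  The kernel of the anchor consists of covectors, which pair with \<open>a\<close> by evaluation on its anchor,
  up to a factor, and covectors separate tangent vectors.
\<close>

lemma ker_coisotropic:
  assumes "a \<in> fibre E x" "\<And>s. s \<in> ker x \<Longrightarrow> pairing E x a s = 0"
  shows "a \<in> ker x"
proof (rule ccontr)
  assume "a \<notin> ker x"
  then have "anchor E x a \<noteq> 0" using assms(1) by simp
  then obtain \<xi> where \<xi>: "\<xi> \<in> cotangent_space M x" "\<xi> (anchor E x a) \<noteq> 0"
    by (rule cotangent_separates[OF anchor_tangent[OF assms(1)]])
  have "cotangent_incl E x \<xi> \<in> ker x"
    unfolding cotangent_sub_ker[symmetric] cotangent_sub_def using \<xi>(1) by (rule imageI)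
  then have "pairing E x a (cotangent_incl E x \<xi>) = 0" by (rule assms(2))
  then show False
    using pairing_sym[OF assms(1) cotangent_incl_fibre(1)[OF \<xi>(1)]]
      cotangent_incl_fibre(2)[OF \<xi>(1) assms(1)] \<xi>(2) by simp
qed

text \<open>
  As \<open>G\<close> is nondegenerate on the kernel \<open>T\<close> of the anchor, a tangent vector lifts to some \<open>a\<close> that
  is \<open>G\<close>-orthogonal to \<open>T\<close>.  Then \<open>J a\<close> is orthogonal to \<open>T\<close> for the pairing, hence lies
  in the coisotropic \<open>T\<close>, so that \<open>a + \<epsilon> J a\<close> is a lift in the eigenspace.
\<close>

lemma anchor_eig_surj:
  assumes \<epsilon>: "\<epsilon> \<in> {1, -1}" and d: "d \<in> tangent_space M x"
  shows "d \<in> anchor E x ` eig \<epsilon> x"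
proof -
  have "anchor E x ` fibre E x = tangent_space M x"
    using exact by (simp add: exact_courant_algebroid_def)
  then obtain e where e: "e \<in> fibre E x" "anchor E x e = d"
    using d by (metis imageE)
  have ker_sub: "ker x \<subseteq> fibre E x" by blast
  have ker_subspace: "subspace (ker x)"
    using subspace_fibre[of x] linear_on_zero[OF subspace_fibre anchor_lin]
    unfolding subspace_def by (auto simp: linear_on_add[OF anchor_lin] linear_on_scale[OF anchor_lin])
  have "nondegenerate_on (ker x) (G x)"
    using gen_metric by (simp add: generalised_metric_def cotangent_sub_ker)
  then have ker_scalar: "scalar_product_on (ker x) (G x)"
    using linear_on_subset[OF metric_lin(1) ker_sub] linear_on_subset[OF metric_lin(2) ker_sub]
    by (auto simp: scalar_product_on_def intro: metric_sym)
  obtain B where B: "finite B" "ker x \<subseteq> span B"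
    using fibre_span[of x] by (elim exE conjE) auto
  obtain t where t: "t \<in> ker x" "\<forall>s\<in>ker x. G x t s = G x e s"
    using ex1_implies_ex[OF nondegenerate_form_represents[OF ker_subspace B ker_scalar
        linear_on_subset[OF metric_lin(1)[OF e(1)] ker_sub]]] by (elim exE conjE)
  define a where "a = e - t"
  have a: "a \<in> fibre E x" using e t by (simp add: a_def subspace_diff subspace_fibre)
  have "anchor E x a = d"
    using linear_on_diff[OF subspace_fibre anchor_lin] e t by (simp add: a_def)
  moreover have "pairing E x (J x a) s = 0" if "s \<in> ker x" for s
    using that t e a pairing_J[OF a] linear_on_diff[OF subspace_fibre metric_lin(2), of s x e t]
    by (simp add: a_def)
  then have "J x a \<in> ker x" by (rule ker_coisotropic[OF J_fibre[OF a]])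
  ultimately have "anchor E x (a + \<epsilon> *\<^sub>R J x a) = d"
    using a subspace_fibre[of x]
    by (simp add: linear_on_add[OF anchor_lin] linear_on_scale[OF anchor_lin] subspace_scale)
  then show ?thesis using add_J_eig[OF \<epsilon> a] by blast
qed

end

section \<open>The Dorfman bracket in terms of the Levi-Civita connection\<close>

locale courant_with_levi_civita = exact_courant_with_metric M E G
  for M :: "('m::topological_space, 'n::euclidean_space) atlas"
    and E :: "('m, 'v::real_vector) courant"
    and G :: "'m \<Rightarrow> 'v \<Rightarrow> 'v \<Rightarrow> real" +
  fixes g :: "'m \<Rightarrow> 'm tangent \<Rightarrow> 'm tangent \<Rightarrow> real"
    and nab :: "'m vector_field \<Rightarrow> 'm vector_field \<Rightarrow> 'm vector_field"
    and H :: "'m form3"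
  assumes base_metric: "metric_of_generalised_metric M E G g"
    and levi_civita: "levi_civita M g nab"
    and phi_iso: "courant_isomorphism M E H (phi M E G g)"
begin

abbreviation "\<Gamma> \<equiv> conn_coeff E g nab"
abbreviation "eigsec \<equiv> eigen_sections M E G"

lemma eigsec_section: "u \<in> eigsec \<epsilon> \<Longrightarrow> u \<in> sections M E"
  and eigsec_eig: "u \<in> eigsec \<epsilon> \<Longrightarrow> u x \<in> eig \<epsilon> x"
  by (simp_all add: eigen_sections_def)

lemma section_fibre: "u \<in> sections M E \<Longrightarrow> u x \<in> fibre E x"
  by (simp add: sections_def)

lemma bracket_section: "u \<in> sections M E \<Longrightarrow> v \<in> sections M E \<Longrightarrow> bracket E u v \<in> sections M E"
  using courant by (simp add: courant_algebroid_def)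

lemma anchor_field: "u \<in> sections M E \<Longrightarrow> anchor_sec E u \<in> vector_fields M"
  using courant by (simp add: courant_algebroid_def bundle_map_to_tangent_def anchor_sec_def)

lemma vector_field_tangent: "X \<in> vector_fields M \<Longrightarrow> X x \<in> tangent_space M x"
  by (simp add: vector_fields_def)

lemma g_scalar: "scalar_product_on (tangent_space M x) (g x)"
  using base_metric by (simp add: metric_of_generalised_metric_def semi_riemannian_metric_def)

lemma g_smooth:
  "X \<in> vector_fields M \<Longrightarrow> Y \<in> vector_fields M \<Longrightarrow> (\<lambda>x. g x (X x) (Y x)) \<in> smooth_funs M"
  using base_metric by (simp add: metric_of_generalised_metric_def semi_riemannian_metric_def)

lemma g_lin:
  assumes "a \<in> tangent_space M x"
  shows "linear_on (tangent_space M x) (\<lambda>c. g x c a)"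
  using g_scalar[of x] assms by (auto simp: scalar_product_on_def)

lemma g_sym: "a \<in> tangent_space M x \<Longrightarrow> b \<in> tangent_space M x \<Longrightarrow> g x a b = g x b a"
  using g_scalar[of x] by (auto simp: scalar_product_on_def)

lemma pairing_eig:
  assumes "\<epsilon> \<in> {1, -1}" "a \<in> eig \<epsilon> x" "b \<in> eig \<epsilon> x"
  shows "pairing E x a b = \<epsilon> * g x (anchor E x a) (anchor E x b)"
proof -
  have "g x (anchor E x a) (anchor E x b) = \<epsilon> * pairing E x a b"
    using base_metric assms metric_eig[OF assms(2) eig_fibre[OF assms(3)]]
    unfolding metric_of_generalised_metric_def by metis
  then show ?thesis using assms(1) by auto
qed

lemma nab_field: "X \<in> vector_fields M \<Longrightarrow> Y \<in> vector_fields M \<Longrightarrow> nab X Y \<in> vector_fields M"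
  using levi_civita by (simp add: levi_civita_def affine_connection_def)

lemma g_lie_bracket:
  assumes "X \<in> vector_fields M" "Y \<in> vector_fields M" "a \<in> tangent_space M x"
  shows "g x (lie_bracket M X Y x) a = g x (nab X Y x) a - g x (nab Y X x) a"
proof -
  have "lie_bracket M X Y = nab X Y - nab Y X"
    using levi_civita assms by (simp add: levi_civita_def)
  then have "lie_bracket M X Y x = nab X Y x - nab Y X x" by simp
  then show ?thesis
    using linear_on_diff[OF subspace_tangent_space g_lin[OF assms(3)]] assms
    by (simp add: nab_field vector_field_tangent)
qed

lemma dir_deriv_g:
  assumes "X \<in> vector_fields M" "Y \<in> vector_fields M" "Z \<in> vector_fields M"
  shows "dir_deriv X (\<lambda>y. c * g y (Y y) (Z y)) x
    = c * (g x (nab X Y x) (Z x) + g x (nab X Z x) (Y x))"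
proof -
  have "linear_on (smooth_funs M) (X x)"
    using vector_field_tangent[OF assms(1), of x] by (simp add: tangent_space_def)
  from linear_on_scale[OF this g_smooth[OF assms(2,3)], of c]
  have "dir_deriv X (\<lambda>y. c * g y (Y y) (Z y)) x = c * dir_deriv X (\<lambda>y. g y (Y y) (Z y)) x"
    by (simp add: dir_deriv_def scaleR_fun_def)
  also have "dir_deriv X (\<lambda>y. g y (Y y) (Z y)) x
      = g x (nab X Y x) (Z x) + g x (Y x) (nab X Z x)"
    using levi_civita assms by (simp add: levi_civita_def)
  also have "g x (Y x) (nab X Z x) = g x (nab X Z x) (Y x)"
    using assms by (intro g_sym vector_field_tangent nab_field)
  finally show ?thesis .
qed

lemma phi_eigsec:
  assumes \<epsilon>: "\<epsilon> \<in> {1, -1}" and u: "u \<in> eigsec \<epsilon>"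
  shows "phi M E G g u = (anchor_sec E u,
    \<lambda>Z. if Z \<in> vector_fields M then (\<lambda>x. \<epsilon> * g x (anchor_sec E u x) (Z x)) else 0)"
proof -
  have fib: "u x \<in> fibre E x" and e: "u x \<in> eig \<epsilon> x" for x
    using eigsec_eig[OF u] eig_fibre by auto
  have "eigen_proj E G \<epsilon> u = u"
    using \<epsilon> fib e by (intro eigen_proj_eqI) (auto intro: subspace_0 subspace_eig)
  moreover have "eigen_proj E G (-\<epsilon>) u = (\<lambda>x. 0)"
    using \<epsilon> fib e by (intro eigen_proj_eqI) (auto intro: subspace_0 subspace_eig)
  moreover have "anchor_sec E (\<lambda>x. 0) = 0"
    using linear_on_zero[OF subspace_fibre anchor_lin] by (simp add: anchor_sec_def fun_eq_iff)
  moreover have "g x 0 (Z x) = 0" if "Z \<in> vector_fields M" for x Z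
    using linear_on_zero[OF subspace_tangent_space g_lin[OF vector_field_tangent[OF that]]] .
  ultimately show ?thesis
    using \<epsilon> by (auto simp: phi_def Let_def intro!: ext)
qed

text \<open>
  The signs \<open>a, b, c\<close> enter through the one-forms \<open>a g(\<pi> u)\<close>, \<open>b g(\<pi> v)\<close>, \<open>c g(\<pi> w)\<close> that \<open>\<phi>\<close>
  attaches to the sections.  Metricity expands each derivative of \<open>g\<close>, and vanishing torsion each Lie bracket, into
  two terms \<open>\<Gamma>\<close>; those in \<open>\<Gamma>(u, w, v)\<close>, \<open>\<Gamma>(v, w, u)\<close> and \<open>\<Gamma>(w, v, u)\<close> cancel.
\<close>

lemma inner_bracket:
  assumes s: "a \<in> {1, -1}" "b \<in> {1, -1}" "c \<in> {1, -1}"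
    and u: "u \<in> eigsec a" and v: "v \<in> eigsec b" and w: "w \<in> eigsec c"
  shows "2 * inner_sec E (bracket E u v) w x
    = (b + c) * \<Gamma> u v w x - (a + c) * \<Gamma> v u w x + (a + b) * \<Gamma> w u v x + pullback3 E H u v w x"
proof -
  let ?X = "anchor_sec E u" and ?Y = "anchor_sec E v" and ?Z = "anchor_sec E w"
  note sec = eigsec_section[OF u] eigsec_section[OF v] eigsec_section[OF w]
  note F = anchor_field[OF sec(1)] anchor_field[OF sec(2)] anchor_field[OF sec(3)]
  note P = phi_eigsec[OF s(1) u] phi_eigsec[OF s(2) v] phi_eigsec[OF s(3) w]
  have hom: "phi M E G g (bracket E p q) = gtb_bracket M H (phi M E G g p) (phi M E G g q)"
    and isom: "gtb_pairing (phi M E G g p) (phi M E G g q) = inner_sec E p q"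
    and anch: "fst (phi M E G g p) = anchor_sec E p"
    if "p \<in> sections M E" "q \<in> sections M E" for p q
    using phi_iso that by (simp_all add: courant_isomorphism_def)
  \<comment> \<open>The Lie bracket is the anchor of the bracket, which is a section.\<close>
  have lie: "lie_bracket M (anchor_sec E p) (anchor_sec E q) \<in> vector_fields M"
    if "p \<in> sections M E" "q \<in> sections M E" for p q
  proof -
    have "anchor_sec E (bracket E p q) = fst (gtb_bracket M H (phi M E G g p) (phi M E G g q))"
      using hom[OF that] anch[OF bracket_section[OF that] that(1)] by simp
    also have "\<dots> = lie_bracket M (anchor_sec E p) (anchor_sec E q)"
      using anch that by (simp add: gtb_bracket_def case_prod_beta)
    finally show ?thesis using anchor_field[OF bracket_section[OF that]] by simp
  qed
  have br: "inner_sec E (bracket E u v) w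
      = gtb_pairing (gtb_bracket M H (phi M E G g u) (phi M E G g v)) (phi M E G g w)"
    using isom[OF bracket_section[OF sec(1,2)] sec(3)] hom[OF sec(1,2)] by simp
  have lie_sym: "g x (anchor_sec E p x) (lie_bracket M (anchor_sec E q) (anchor_sec E r) x)
      = g x (nab (anchor_sec E q) (anchor_sec E r) x) (anchor_sec E p x)
        - g x (nab (anchor_sec E r) (anchor_sec E q) x) (anchor_sec E p x)"
    if "p \<in> sections M E" "q \<in> sections M E" "r \<in> sections M E" for p q r
    using g_lie_bracket[OF anchor_field anchor_field vector_field_tangent[OF anchor_field]] that
      g_sym[OF vector_field_tangent[OF anchor_field] vector_field_tangent[OF lie]]
    by simp
  have "2 * inner_sec E (bracket E u v) w x
      = dir_deriv ?X (\<lambda>y. b * g y (?Y y) (?Z y)) x - b * g x (?Y x) (lie_bracket M ?X ?Z x)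
        - (dir_deriv ?Y (\<lambda>y. a * g y (?X y) (?Z y)) x - dir_deriv ?Z (\<lambda>y. a * g y (?X y) (?Y y)) x
           - a * g x (?X x) (lie_bracket M ?Y ?Z x))
        + H ?X ?Y ?Z x + c * g x (?Z x) (lie_bracket M ?X ?Y x)"
    unfolding br P
    by (simp add: gtb_pairing_def gtb_bracket_def lie_deriv1_def ext_deriv1_def F lie sec)
  also have "\<dots> = (b + c) * \<Gamma> u v w x - (a + c) * \<Gamma> v u w x + (a + b) * \<Gamma> w u v x
      + pullback3 E H u v w x"
    by (simp add: dir_deriv_g F lie_sym sec conn_coeff_def pullback3_def algebra_simps)
  finally show ?thesis .
qed

end

section \<open>The canonical connection\<close>

locale canonical_courant_connection = courant_with_levi_civita M E G g nab H
  for M :: "('m::topological_space, 'n::euclidean_space) atlas"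
    and E :: "('m, 'v::real_vector) courant"
    and G :: "'m \<Rightarrow> 'v \<Rightarrow> 'v \<Rightarrow> real" and g nab H +
  fixes Dt D :: "('m, 'v) gen_conn"
  assumes D_tilde: "is_D_tilde M E G nab Dt"
    and canonical: "canonical_connection M E Dt D"
begin

lemma Dt_section: "u \<in> sections M E \<Longrightarrow> v \<in> sections M E \<Longrightarrow> Dt u v \<in> sections M E"
  using D_tilde by (simp add: is_D_tilde_def generalised_connection_def)

text \<open>
  \<open>Dt u v\<close> is a value of \<open>inv_into\<close>, which is a lift of the covariant derivative only because the
  anchor maps the eigenspace onto the tangent space.
\<close>

lemma Dt_pure:
  assumes \<epsilon>: "\<epsilon> \<in> {1, -1}" and u: "u \<in> eigsec \<epsilon>" and v: "v \<in> eigsec \<epsilon>" and w: "w \<in> eigsec \<epsilon>"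
  shows "inner_sec E (Dt u v) w x = \<epsilon> * \<Gamma> u v w x"
proof -
  let ?N = "nab (anchor_sec E u) (anchor_sec E v) x"
  have Dt: "Dt u v = (\<lambda>x. inv_into (eig \<epsilon> x) (anchor E x) (nab (anchor_sec E u) (anchor_sec E v) x))"
    using D_tilde \<epsilon> u v unfolding is_D_tilde_def by blast
  have "?N \<in> tangent_space M x"
    using u v by (intro vector_field_tangent nab_field anchor_field eigsec_section)
  then have "?N \<in> anchor E x ` eig \<epsilon> x" by (rule anchor_eig_surj[OF \<epsilon>])
  then have "Dt u v x \<in> eig \<epsilon> x" "anchor E x (Dt u v x) = ?N"
    unfolding Dt by (rule inv_into_into, rule f_inv_into_f)
  then show ?thesis
    using pairing_eig[OF \<epsilon> _ eigsec_eig[OF w]]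
    by (simp add: inner_sec_def conn_coeff_def anchor_sec_def)
qed

lemma Dt_mixed_eig:
  assumes \<epsilon>: "\<epsilon> \<in> {1, -1}" and u: "u \<in> eigsec \<epsilon>" and v: "v \<in> eigsec (-\<epsilon>)"
  shows "Dt u v x \<in> eig (-\<epsilon>) x" "bracket E u v x - Dt u v x \<in> eig \<epsilon> x"
proof -
  have "Dt u v = eigen_proj E G (-\<epsilon>) (bracket E u v)"
    using D_tilde \<epsilon> u v unfolding is_D_tilde_def by blast
  then show "Dt u v x \<in> eig (-\<epsilon>) x" "bracket E u v x - Dt u v x \<in> eig \<epsilon> x"
    using eigen_proj_eig[of "-\<epsilon>" "bracket E u v" x] \<epsilon>
      section_fibre[OF bracket_section[OF eigsec_section[OF u] eigsec_section[OF v]]] by auto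
qed

lemma inner_diff:
  assumes "u x \<in> fibre E x" "v x \<in> fibre E x" "w x \<in> fibre E x"
  shows "inner_sec E (u - v) w x = inner_sec E u w x - inner_sec E v w x"
  using linear_on_diff[OF subspace_fibre pairing_lin(2)[OF assms(3)] assms(1,2)]
  by (simp add: inner_sec_def)

lemma inner_mixed_zero:
  assumes "\<epsilon> \<in> {1, -1}" "a x \<in> eig \<epsilon> x" "b x \<in> eig (-\<epsilon>) x"
  shows "inner_sec E a b x = 0"
  using eig_orthogonal[OF _ assms(2,3)] assms(1) by (auto simp: inner_sec_def)

text \<open>The part of the bracket that the projection removes is orthogonal to \<open>w\<close>.\<close>

lemma Dt_mixed:
  assumes \<epsilon>: "\<epsilon> \<in> {1, -1}" and u: "u \<in> eigsec \<epsilon>" and v: "v \<in> eigsec (-\<epsilon>)" and w: "w \<in> eigsec (-\<epsilon>)"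
  shows "inner_sec E (Dt u v) w x = inner_sec E (bracket E u v) w x"
proof -
  note sec = eigsec_section[OF u] eigsec_section[OF v] eigsec_section[OF w]
  have "inner_sec E (bracket E u v - Dt u v) w x = 0"
    using Dt_mixed_eig(2)[OF \<epsilon> u v] by (intro inner_mixed_zero[OF \<epsilon>]) (simp_all add: eigsec_eig[OF w])
  then show ?thesis
    using inner_diff[of "bracket E u v" x "Dt u v" w]
    by (simp add: section_fibre bracket_section Dt_section sec)
qed

lemma torsion_expand:
  assumes "u \<in> sections M E" "v \<in> sections M E" "w \<in> sections M E"
  shows "gen_torsion E Dt u v w x = inner_sec E (Dt u v) w x - inner_sec E (Dt v u) w x
    - inner_sec E (bracket E u v) w x + inner_sec E (Dt w u) v x"
proof -
  have "(Dt u v - Dt v u) x \<in> fibre E x"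
    using assms by (simp add: subspace_diff[OF subspace_fibre] section_fibre Dt_section)
  then show ?thesis
    using assms by (simp add: gen_torsion_def inner_diff section_fibre Dt_section bracket_section)
qed

text \<open>
  The three covariant derivatives produce the terms \<open>\<Gamma>\<close> of \<open>inner_bracket\<close>, so that only its
  \<open>H\<close>-term remains.
\<close>

lemma torsion_pure:
  assumes \<epsilon>: "\<epsilon> \<in> {1, -1}" and u: "u \<in> eigsec \<epsilon>" and v: "v \<in> eigsec \<epsilon>" and w: "w \<in> eigsec \<epsilon>"
  shows "gen_torsion E Dt u v w x = - pullback3 E H u v w x / 2"
  using inner_bracket[OF \<epsilon> \<epsilon> \<epsilon> u v w, of x] torsion_expand[of u v w x]
    Dt_pure[OF \<epsilon> u v w, of x] Dt_pure[OF \<epsilon> v u w, of x] Dt_pure[OF \<epsilon> w u v, of x]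
    eigsec_section[OF u] eigsec_section[OF v] eigsec_section[OF w]
  by (simp add: algebra_simps)

text \<open>
  \<open>Dt v u\<close> and \<open>Dt w u\<close> stay in the eigenbundle of \<open>u\<close>, which is orthogonal to \<open>v\<close> and \<open>w\<close>.
\<close>

lemma torsion_mixed:
  assumes \<epsilon>: "\<epsilon> \<in> {1, -1}" and u: "u \<in> eigsec \<epsilon>" and v: "v \<in> eigsec (-\<epsilon>)" and w: "w \<in> eigsec (-\<epsilon>)"
  shows "gen_torsion E Dt u v w x = 0"
proof -
  have m\<epsilon>: "-\<epsilon> \<in> {1, -1}" using \<epsilon> by auto
  have u': "u \<in> eigsec (- (-\<epsilon>))" using u by simp
  have "inner_sec E (Dt v u) w x = 0"
    using Dt_mixed_eig(1)[OF m\<epsilon> v u', of x] by (intro inner_mixed_zero[OF \<epsilon>]) (simp_all add: eigsec_eig[OF w])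
  moreover have "inner_sec E (Dt w u) v x = 0"
    using Dt_mixed_eig(1)[OF m\<epsilon> w u', of x] by (intro inner_mixed_zero[OF \<epsilon>]) (simp_all add: eigsec_eig[OF v])
  ultimately show ?thesis
    using torsion_expand[of u v w x] Dt_mixed[OF \<epsilon> u v w, of x]
      eigsec_section[OF u] eigsec_section[OF v] eigsec_section[OF w] by simp
qed

lemma D_eq:
  assumes "u \<in> sections M E" "v \<in> sections M E" "w \<in> sections M E"
  shows "inner_sec E (D u v) w x = inner_sec E (Dt u v) w x - gen_torsion E Dt u v w x / 3"
  using canonical assms by (simp add: canonical_connection_def)

lemma pure_coefficients:
  assumes \<epsilon>: "\<epsilon> \<in> {1, -1}" and u: "u \<in> eigsec \<epsilon>" and v: "v \<in> eigsec \<epsilon>" and w: "w \<in> eigsec \<epsilon>"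
  shows "inner_sec E (D u v) w x = 1/6 * pullback3 E H u v w x + \<epsilon> * \<Gamma> u v w x"
  using D_eq[OF eigsec_section[OF u] eigsec_section[OF v] eigsec_section[OF w], of x]
    torsion_pure[OF assms, of x] Dt_pure[OF assms, of x] by simp

lemma mixed_coefficients:
  assumes \<epsilon>: "\<epsilon> \<in> {1, -1}" and u: "u \<in> eigsec \<epsilon>" and v: "v \<in> eigsec (-\<epsilon>)" and w: "w \<in> eigsec (-\<epsilon>)"
  shows "inner_sec E (D u v) w x = 1/2 * pullback3 E H u v w x - \<epsilon> * \<Gamma> u v w x"
proof -
  have m\<epsilon>: "-\<epsilon> \<in> {1, -1}" using \<epsilon> by auto
  show ?thesis
    using D_eq[OF eigsec_section[OF u] eigsec_section[OF v] eigsec_section[OF w], of x]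
      torsion_mixed[OF assms, of x] Dt_mixed[OF assms, of x]
      inner_bracket[OF \<epsilon> m\<epsilon> m\<epsilon> u v w, of x] by simp
qed

end

theorem proposition3p2:
  fixes M :: "('m::{t2_space,second_countable_topology}, 'n::euclidean_space) atlas"
    and E :: "('m, 'v::real_vector) courant"
    and G :: "'m \<Rightarrow> 'v \<Rightarrow> 'v \<Rightarrow> real"
    and g :: "'m \<Rightarrow> 'm tangent \<Rightarrow> 'm tangent \<Rightarrow> real"
    and nab :: "'m vector_field \<Rightarrow> 'm vector_field \<Rightarrow> 'm vector_field"
    and H :: "'m form3"
    and Dt D :: "('m, 'v) gen_conn"
  assumes "smooth_manifold M"
    and "exact_courant_algebroid M E"
    and "generalised_metric M E G"
    and "metric_of_generalised_metric M E G g"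
    and "levi_civita M g nab"
    and "closed_three_form M H"
    and "courant_isomorphism M E H (phi M E G g)"
    and "is_D_tilde M E G nab Dt"
    and "canonical_connection M E Dt D"
  shows
    "(\<forall>\<epsilon>\<in>{1, -1}. \<forall>u\<in>eigen_sections M E G \<epsilon>. \<forall>v\<in>eigen_sections M E G \<epsilon>. \<forall>w\<in>eigen_sections M E G \<epsilon>.
        constant_products E u v w \<longrightarrow>
        (\<forall>x. inner_sec E (D u v) w x
               = 1/6 * pullback3 E H u v w x + \<epsilon> * conn_coeff E g nab u v w x)) \<and>
     (\<forall>u\<in>eigen_sections M E G 1. \<forall>v\<in>eigen_sections M E G (-1). \<forall>w\<in>eigen_sections M E G (-1).
        constant_products E u v w \<longrightarrow>
        (\<forall>x. inner_sec E (D u v) w x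
               = 1/2 * pullback3 E H u v w x - conn_coeff E g nab u v w x)) \<and>
     (\<forall>u\<in>eigen_sections M E G (-1). \<forall>v\<in>eigen_sections M E G 1. \<forall>w\<in>eigen_sections M E G 1.
        constant_products E u v w \<longrightarrow>
        (\<forall>x. inner_sec E (D u v) w x
               = 1/2 * pullback3 E H u v w x + conn_coeff E g nab u v w x))"
proof -
  interpret canonical_courant_connection M E G g nab H Dt D
    using assms(2-5,7-9) by unfold_locales
  show ?thesis
  proof (intro conjI ballI impI allI)
    fix \<epsilon> u v w x
    assume "\<epsilon> \<in> {1, -1::real}" "u \<in> eigsec \<epsilon>" "v \<in> eigsec \<epsilon>" "w \<in> eigsec \<epsilon>"
    then show "inner_sec E (D u v) w x = 1/6 * pullback3 E H u v w x + \<epsilon> * \<Gamma> u v w x"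
      by (rule pure_coefficients)
  next
    fix u v w x
    assume "u \<in> eigsec 1" "v \<in> eigsec (-1)" "w \<in> eigsec (-1)"
    then show "inner_sec E (D u v) w x = 1/2 * pullback3 E H u v w x - \<Gamma> u v w x"
      using mixed_coefficients[of 1 u v w x] by simp
  next
    fix u v w x
    assume "u \<in> eigsec (-1)" "v \<in> eigsec 1" "w \<in> eigsec 1"
    then show "inner_sec E (D u v) w x = 1/2 * pullback3 E H u v w x + \<Gamma> u v w x"
      using mixed_coefficients[of "-1" u v w x] by simp
  qed
qed

end
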